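(* Let $((\mathfrak g,[\cdot,\cdot]_{\mathfrak g},\phi_{\mathfrak g}),\omega)$ be a regular symplectic hom-Lie algebra, and let $\star:\mathfrak g\times\mathfrak g\to\mathfrak g$ be the bilinear map defined by $$\omega(x\star y,\phi_{\mathfrak g}(z))=-\omega(\phi_{\mathfrak g}(y),[x,z]_{\mathfrak g})\qquad\forall x,y,z\in\mathfrak g.$$ Then $(\mathfrak g,\star,\phi_{\mathfrak g})$ is a hom-left-symmetric algebra. Furthermore, the hom-Lie algebra $\mathfrak g$ is its sub-adjacent hom-Lie algebra, i.e. $[x,y]_{\mathfrak g}=x\star y-y\star x$ for all $x,y\in\mathfrak g$.
   Context: **Hom-Lie algebra.** A triple $(\mathfrak g,[\cdot,\cdot]_{\mathfrak g},\phi_{\mathfrak g})$ of a (real) vector space, a skew-symmetric bilinear bracket and a linear map $\phi_{\mathfrak g}:\mathfrak g\to\mathfrak g$ with $\phi_{\mathfrak g}[u,v]_{\mathfrak g}=[\phi_{\mathfrak g}(u),\phi_{\mathfrak g}(v)]_{\mathfrak g}$ and $[\phi_{\mathfrak g}(u),[v,w]_{\mathfrak g}]_{\mathfrak g}+[\phi_{\mathfrak g}(v),[w,u]_{\mathfrak g}]_{\mathfrak g}+[\phi_{\mathfrak g}(w),[u,v]_{\mathfrak g}]_{\mathfrak g}=0$. It is regular if $\phi_{\mathfrak g}$ is nondegenerate (invertible). **Symplectic hom-Lie algebra.** A regular hom-Lie algebra with a skew-symmetric bilinear form $\omega\in\wedge^2\mathfrak g^*$ such that: $\omega$ is nondegenerate,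 i.e. $\omega^\sharp:\mathfrak g\to\mathfrak g^*$, $\langle\omega^\sharp(x),y\rangle=\omega(x,y)$, is invertible; $\omega(\phi_{\mathfrak g}(x),\phi_{\mathfrak g}(y))=\omega(x,y)$; and $\omega(\phi_{\mathfrak g}(x),[y,z]_{\mathfrak g})+\omega(\phi_{\mathfrak g}(y),[z,x]_{\mathfrak g})+\omega(\phi_{\mathfrak g}(z),[x,y]_{\mathfrak g})=0$ for all $x,y,z$. **Hom-left-symmetric algebra.** A triple $(V,\star,\phi)$ of a vector space $V$, a bilinear map $\star:V\times V\to V$ and a linear map $\phi:V\to V$ such that $\phi(x\star y)=\phi(x)\star\phi(y)$ and $\phi(x)\star(y\star z)-(x\star y)\star\phi(z)=\phi(y)\star(x\star z)-(y\star x)\star\phi(z)$ for all $x,y,z\in V$. Its sub-adjacent hom-Lie algebra is $(V,[\cdot,\cdot]_V,\phi)$ with $[x,y]_V=x\star y-y\star x$. *)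

theory Defs
  imports "HOL-Analysis.Analysis"
begin

text \<open>
  The underlying real vector space is the carrier of a type of class \<open>real_vector\<close>; no dimension
  is prescribed.
\<close>

definition hom_lie_algebra ::
    "('a::real_vector \<Rightarrow> 'a \<Rightarrow> 'a) \<Rightarrow> ('a \<Rightarrow> 'a) \<Rightarrow> bool" where
  "hom_lie_algebra br \<phi> \<longleftrightarrow>
     bilinear br \<and> (\<forall>u v. br u v = - br v u) \<and> linear \<phi> \<and>
     (\<forall>u v. \<phi> (br u v) = br (\<phi> u) (\<phi> v)) \<and>
     (\<forall>u v w. br (\<phi> u) (br v w) + br (\<phi> v) (br w u) + br (\<phi> w) (br u v) = 0)"

definition regular_hom_lie_algebra ::
    "('a::real_vector \<Rightarrow> 'a \<Rightarrow> 'a) \<Rightarrow> ('a \<Rightarrow> 'a) \<Rightarrow> bool" where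
  "regular_hom_lie_algebra br \<phi> \<longleftrightarrow> hom_lie_algebra br \<phi> \<and> bij \<phi>"

definition dual_space :: "('a::real_vector \<Rightarrow> real) set" where
  "dual_space = {f. linear f}"

definition form_sharp :: "('a::real_vector \<Rightarrow> 'a \<Rightarrow> real) \<Rightarrow> 'a \<Rightarrow> ('a \<Rightarrow> real)" where
  "form_sharp \<omega> x = (\<lambda>y. \<omega> x y)"

text \<open>
  Nondegeneracy is invertibility of \<open>form_sharp \<omega>\<close> as a map onto the full algebraic dual, not merely
  its injectivity.
\<close>

definition nondegenerate_form :: "('a::real_vector \<Rightarrow> 'a \<Rightarrow> real) \<Rightarrow> bool" where
  "nondegenerate_form \<omega> \<longleftrightarrow> bij_betw (form_sharp \<omega>) UNIV dual_space"

definition symplectic_hom_lie_algebra ::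
    "('a::real_vector \<Rightarrow> 'a \<Rightarrow> 'a) \<Rightarrow> ('a \<Rightarrow> 'a) \<Rightarrow> ('a \<Rightarrow> 'a \<Rightarrow> real) \<Rightarrow> bool" where
  "symplectic_hom_lie_algebra br \<phi> \<omega> \<longleftrightarrow>
     regular_hom_lie_algebra br \<phi> \<and>
     bilinear \<omega> \<and> (\<forall>x y. \<omega> x y = - \<omega> y x) \<and>
     nondegenerate_form \<omega> \<and>
     (\<forall>x y. \<omega> (\<phi> x) (\<phi> y) = \<omega> x y) \<and>
     (\<forall>x y z. \<omega> (\<phi> x) (br y z) + \<omega> (\<phi> y) (br z x) + \<omega> (\<phi> z) (br x y) = 0)"

definition hom_left_symmetric_algebra ::
    "('a::real_vector \<Rightarrow> 'a \<Rightarrow> 'a) \<Rightarrow> ('a \<Rightarrow> 'a) \<Rightarrow> bool" where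
  "hom_left_symmetric_algebra m \<phi> \<longleftrightarrow>
     bilinear m \<and> linear \<phi> \<and>
     (\<forall>x y. \<phi> (m x y) = m (\<phi> x) (\<phi> y)) \<and>
     (\<forall>x y z. m (\<phi> x) (m y z) - m (m x y) (\<phi> z) = m (\<phi> y) (m x z) - m (m y x) (\<phi> z))"

definition sub_adjacent_bracket :: "('a::real_vector \<Rightarrow> 'a \<Rightarrow> 'a) \<Rightarrow> 'a \<Rightarrow> 'a \<Rightarrow> 'a" where
  "sub_adjacent_bracket m x y = m x y - m y x"

definition symplectic_product_eq ::
    "('a::real_vector \<Rightarrow> 'a \<Rightarrow> 'a) \<Rightarrow> ('a \<Rightarrow> 'a) \<Rightarrow> ('a \<Rightarrow> 'a \<Rightarrow> real) \<Rightarrow> ('a \<Rightarrow> 'a \<Rightarrow> 'a) \<Rightarrow> bool" where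
  "symplectic_product_eq br \<phi> \<omega> m \<longleftrightarrow>
     (\<forall>x y z. \<omega> (m x y) (\<phi> z) = - \<omega> (\<phi> y) (br x z))"

end

theory Submission
  imports Defs
begin

text \<open>
  Since \<open>\<phi>\<close> is surjective and \<open>\<omega>\<close> nondegenerate, a vector \<open>u\<close> is determined by the values
  \<open>\<omega> u (\<phi> z)\<close>, and every linear functional arises in this way; this gives existence and uniqueness
  of the product. Testing against \<open>\<phi> z\<close>, the commutator identity becomes the cocycle condition of
  \<open>\<omega>\<close>. Testing against \<open>\<phi> (\<phi> w)\<close>, multiplicativity of \<open>\<phi>\<close> becomes \<open>\<phi>\<close>-invariance of \<open>\<omega>\<close>, and
  \<open>x \<mapsto> m x\<close> turns out to be the \<open>\<phi>\<close>-twisted coadjoint action transported by \<open>\<omega>\<close>, so that left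
  symmetry becomes the hom-Jacobi identity.
\<close>

context
  fixes br :: "'a::real_vector \<Rightarrow> 'a \<Rightarrow> 'a"
    and \<phi> :: "'a \<Rightarrow> 'a"
    and \<omega> :: "'a \<Rightarrow> 'a \<Rightarrow> real"
  assumes symplectic: "symplectic_hom_lie_algebra br \<phi> \<omega>"
begin

lemma bilinear_br: "bilinear br"
  and br_skew: "br u v = - br v u"
  and linear_\<phi>: "linear \<phi>"
  and \<phi>_br: "\<phi> (br u v) = br (\<phi> u) (\<phi> v)"
  and hom_Jacobi: "br (\<phi> u) (br v w) + br (\<phi> v) (br w u) + br (\<phi> w) (br u v) = 0"
  and bij_\<phi>: "bij \<phi>"
  and bilinear_\<omega>: "bilinear \<omega>"
  and \<omega>_skew: "\<omega> x y = - \<omega> y x"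
  and nondegenerate: "nondegenerate_form \<omega>"
  and \<omega>_\<phi>: "\<omega> (\<phi> x) (\<phi> y) = \<omega> x y"
  and \<omega>_cocycle: "\<omega> (\<phi> x) (br y z) + \<omega> (\<phi> y) (br z x) + \<omega> (\<phi> z) (br x y) = 0"
  using symplectic
  unfolding symplectic_hom_lie_algebra_def regular_hom_lie_algebra_def hom_lie_algebra_def
  by blast+

lemmas bilinear_simps =
  bilinear_ladd[OF bilinear_\<omega>] bilinear_radd[OF bilinear_\<omega>]
  bilinear_lsub[OF bilinear_\<omega>] bilinear_rsub[OF bilinear_\<omega>]
  bilinear_lmul[OF bilinear_\<omega>] bilinear_rmul[OF bilinear_\<omega>]
  bilinear_lneg[OF bilinear_\<omega>] bilinear_rneg[OF bilinear_\<omega>]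
  bilinear_ladd[OF bilinear_br] bilinear_radd[OF bilinear_br]
  bilinear_lmul[OF bilinear_br] bilinear_rmul[OF bilinear_br]
  linear_add[OF linear_\<phi>] linear_scale[OF linear_\<phi>]

lemma \<phi>_surj: obtains w where "z = \<phi> w"
  using bij_\<phi> by (metis bij_pointE)

lemma form_eqI:
  assumes "\<And>z. \<omega> u (\<phi> z) = \<omega> v (\<phi> z)"
  shows "u = v"
proof -
  have "form_sharp \<omega> u = form_sharp \<omega> v"
    unfolding form_sharp_def by (rule ext) (metis \<phi>_surj assms)
  moreover have "inj (form_sharp \<omega>)"
    using nondegenerate by (simp add: nondegenerate_form_def bij_betw_def)
  ultimately show ?thesis
    by (simp add: inj_eq)
qed

lemma form_represents:
  assumes "linear f"
  obtains u where "\<And>y. \<omega> u y = f y"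
proof -
  have "f \<in> range (form_sharp \<omega>)"
    using nondegenerate assms by (simp add: nondegenerate_form_def bij_betw_def dual_space_def)
  then show ?thesis
    using that by (auto simp: form_sharp_def)
qed

lemma symplectic_product_exists:
  "\<exists>m. symplectic_product_eq br \<phi> \<omega> m"
proof -
  have "\<exists>u. \<forall>z. \<omega> u (\<phi> z) = - \<omega> (\<phi> y) (br x z)" for x y
  proof -
    \<comment> \<open>The value at \<open>\<phi> z\<close> is prescribed, so the functional is
      precomposed with a linear inverse \<open>\<psi>\<close> of \<open>\<phi>\<close> before being
      represented by \<open>\<omega>\<close>.\<close>
    obtain \<psi> where \<psi>: "linear \<psi>" "\<psi> \<circ> \<phi> = id"
      using linear_injective_left_inverse[OF linear_\<phi>] bij_\<phi> by (auto simp: bij_def)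
    have "linear (\<lambda>z. - \<omega> (\<phi> y) (br x (\<psi> z)))"
      by (rule linearI)
        (simp_all add: bilinear_simps linear_add[OF \<psi>(1)] linear_scale[OF \<psi>(1)])
    then obtain u where "\<And>z. \<omega> u z = - \<omega> (\<phi> y) (br x (\<psi> z))"
      using form_represents by blast
    then show ?thesis
      using \<psi>(2) by (metis comp_apply id_apply)
  qed
  then have "\<forall>x y. \<exists>u. \<forall>z. \<omega> u (\<phi> z) = - \<omega> (\<phi> y) (br x z)"
    by blast
  then show ?thesis
    unfolding symplectic_product_eq_def choice_iff .
qed

context
  fixes m :: "'a \<Rightarrow> 'a \<Rightarrow> 'a"
  assumes product: "symplectic_product_eq br \<phi> \<omega> m"
begin

lemma product_eq: "\<omega> (m x y) (\<phi> z) = - \<omega> (\<phi> y) (br x z)"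
  using product by (simp add: symplectic_product_eq_def)

text \<open>The right-hand side of \<open>product_eq\<close> is linear in \<open>x\<close> and in
  \<open>y\<close>, and testing against all \<open>\<phi> z\<close> carries this over to
  \<open>m\<close>.\<close>

lemma bilinear_product: "bilinear m"
  unfolding bilinear_def
  by (intro conjI allI linearI; rule form_eqI) (simp_all add: product_eq bilinear_simps)

lemma product_commutator: "br x y = m x y - m y x"
proof (rule form_eqI)
  fix z
  show "\<omega> (br x y) (\<phi> z) = \<omega> (m x y - m y x) (\<phi> z)"
    \<comment> \<open>The tested right-hand side is
      \<open>\<omega> (\<phi> y) (br z x) + \<omega> (\<phi> x) (br y z)\<close>, two of the three
      cocycle terms.\<close>
    using \<omega>_cocycle[of x y z] \<omega>_skew[of "br x y" "\<phi> z"] br_skew[of z x]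
    by (simp add: bilinear_simps product_eq)
qed

lemma \<phi>_product: "\<phi> (m x y) = m (\<phi> x) (\<phi> y)"
proof (rule form_eqI)
  fix z
  obtain w where "z = \<phi> w" by (rule \<phi>_surj)
  then show "\<omega> (\<phi> (m x y)) (\<phi> z) = \<omega> (m (\<phi> x) (\<phi> y)) (\<phi> z)"
    by (simp add: \<omega>_\<phi> product_eq flip: \<phi>_br)
qed

lemma product_product_eq:
  "\<omega> (m (\<phi> x) (m y z)) (\<phi> (\<phi> w)) = \<omega> (\<phi> (\<phi> z)) (br (\<phi> y) (br x w))"
proof -
  \<comment> \<open>The outer product leaves \<open>m y z\<close> paired with \<open>br x w\<close>;
    writing the latter as an image of \<open>\<phi>\<close> lets \<open>product_eq\<close> apply a
    second time.\<close>
  obtain u where u: "br x w = \<phi> u" by (rule \<phi>_surj)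
  have "\<omega> (m (\<phi> x) (m y z)) (\<phi> (\<phi> w)) = - \<omega> (m y z) (\<phi> u)"
    by (simp add: product_eq \<omega>_\<phi> u flip: \<phi>_br)
  \<comment> \<open>Applying \<open>\<phi>\<close> to both arguments of \<open>\<omega>\<close>
    turns \<open>u\<close> back into \<open>\<phi> u\<close>, that is,
    \<open>br x w\<close>.\<close>
  also have "\<dots> = \<omega> (\<phi> (\<phi> z)) (br (\<phi> y) (\<phi> u))"
    by (simp add: product_eq \<omega>_\<phi> flip: \<phi>_br)
  finally show ?thesis
    by (simp add: u)
qed

text \<open>Left multiplication is a \<open>\<phi>\<close>-twisted representation of the bracket:
  tested against \<open>\<phi> (\<phi> w)\<close>, all terms pair \<open>\<phi> (\<phi> z)\<close>
  with double brackets related by hom-Jacobi.\<close>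

lemma product_br_left: "m (br x y) (\<phi> z) = m (\<phi> x) (m y z) - m (\<phi> y) (m x z)"
proof (rule form_eqI)
  fix v
  obtain w where v: "v = \<phi> w" by (rule \<phi>_surj)
  have "br (\<phi> w) (br x y) = br (\<phi> y) (br x w) - br (\<phi> x) (br y w)"
    using hom_Jacobi[of w x y] br_skew[of w x] bilinear_rneg[OF bilinear_br]
    by (simp add: algebra_simps eq_neg_iff_add_eq_0)
  then have "\<omega> (\<phi> (\<phi> z)) (br (\<phi> w) (br x y)) =
      \<omega> (\<phi> (\<phi> z)) (br (\<phi> y) (br x w)) - \<omega> (\<phi> (\<phi> z)) (br (\<phi> x) (br y w))"
    by (simp add: bilinear_simps)
  then show "\<omega> (m (br x y) (\<phi> z)) (\<phi> v) =
      \<omega> (m (\<phi> x) (m y z) - m (\<phi> y) (m x z)) (\<phi> v)"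
    by (simp add: v product_eq[of "br x y"] product_product_eq bilinear_simps
        br_skew[of "br x y" "\<phi> w"])
qed

lemma product_hom_left_symmetric: "hom_left_symmetric_algebra m \<phi>"
  unfolding hom_left_symmetric_algebra_def
proof (intro conjI allI)
  fix x y z
  \<comment> \<open>Expanding \<open>br x y\<close> as a commutator in
    \<open>product_br_left\<close> gives left symmetry up to rearrangement.\<close>
  have "m (m x y) (\<phi> z) - m (m y x) (\<phi> z) = m (\<phi> x) (m y z) - m (\<phi> y) (m x z)"
    using product_br_left[of x y z]
    by (simp add: product_commutator bilinear_lsub[OF bilinear_product])
  then show "m (\<phi> x) (m y z) - m (m x y) (\<phi> z) = m (\<phi> y) (m x z) - m (m y x) (\<phi> z)"
    by (simp add: algebra_simps)
qed (use bilinear_product linear_\<phi> \<phi>_product in auto)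

end

lemma symplectic_product_unique:
  assumes "symplectic_product_eq br \<phi> \<omega> m" "symplectic_product_eq br \<phi> \<omega> m'"
  shows "m = m'"
  by (intro ext form_eqI) (simp add: product_eq assms)

end

theorem proposition5p10:
  fixes br :: "'a::real_vector \<Rightarrow> 'a \<Rightarrow> 'a"
    and \<phi> :: "'a \<Rightarrow> 'a"
    and \<omega> :: "'a \<Rightarrow> 'a \<Rightarrow> real"
  assumes "symplectic_hom_lie_algebra br \<phi> \<omega>"
  shows "(\<exists>!m. bilinear m \<and> symplectic_product_eq br \<phi> \<omega> m) \<and>
    (\<forall>m. bilinear m \<and> symplectic_product_eq br \<phi> \<omega> m \<longrightarrow>
       hom_left_symmetric_algebra m \<phi> \<and>
       (\<forall>x y. br x y = sub_adjacent_bracket m x y))"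
proof
  show "\<exists>!m. bilinear m \<and> symplectic_product_eq br \<phi> \<omega> m"
    using symplectic_product_exists[OF assms] bilinear_product[OF assms]
      symplectic_product_unique[OF assms]
    by metis
  show "\<forall>m. bilinear m \<and> symplectic_product_eq br \<phi> \<omega> m \<longrightarrow>
       hom_left_symmetric_algebra m \<phi> \<and>
       (\<forall>x y. br x y = sub_adjacent_bracket m x y)"
    unfolding sub_adjacent_bracket_def
    using product_hom_left_symmetric[OF assms] product_commutator[OF assms]
    by blast
qed

end
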